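(* Fix an integer $k \ge 3$. Let $f:\mathbb{Z}_{>0}\to\mathbb{C}$ be a multiplicative function such that \[ f(a_1^2 + a_2^2 + \dotsb + a_k^2) = f(a_1^2) + f(a_2^2) + \dotsb + f(a_k^2) \] for all positive integers $a_1,\dots,a_k$. Then $f(n)=n$ for all positive integers $n$. (In the paper's terminology: the set of positive squares is a $k$-additive uniqueness set for multiplicative functions.)
   Context: A function $f$ on the positive integers is multiplicative if $f(1)=1$ and $f(mn)=f(m)f(n)$ whenever $\gcd(m,n)=1$. A set $E$ is called a $k$-additive uniqueness set for a class $S$ of arithmetic functions if the only $f\in S$ satisfying $f(e_1+\dots+e_k)=f(e_1)+\dots+f(e_k)$ for all $e_1,\dots,e_k\in E$ is the identity function. *)

theory Defs
  imports Complex_Main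
begin

(* Functions on the positive integers are represented by functions on nat whose value
   at 0 is unconstrained and never used. *)
definition multiplicative_fun :: "(nat \<Rightarrow> complex) \<Rightarrow> bool" where
  "multiplicative_fun f \<longleftrightarrow>
     f 1 = 1 \<and> (\<forall>m n. m > 0 \<longrightarrow> n > 0 \<longrightarrow> gcd m n = 1 \<longrightarrow> f (m * n) = f m * f n)"

end

theory Submission
  imports Defs "HOL-Computational_Algebra.Primes"
begin

text \<open>
  Put \<open>g(a) = f(a\<^sup>2)\<close>. Two equal sums of three positive squares give equal sums of values of \<open>g\<close>.
  Identities such as \<open>(2x + 1)\<^sup>2 + (x - 2)\<^sup>2 = (2x - 1)\<^sup>2 + (x + 2)\<^sup>2\<close> turn this into a recursion, which
  forces \<open>g(a) = A a\<^sup>2 + B + C [a odd]\<close>. Multiplicativity at \<open>9 \<cdot> 25\<close> gives \<open>A \<in> {0, 1}\<close>; the case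
  \<open>A = 0\<close> contradicts multiplicativity at small numbers (for \<open>k \<ge> 5\<close>: at large ones, where \<open>f\<close> would be
  constantly \<open>k\<close>), and \<open>A = 1\<close> forces \<open>B = C = 0\<close> by multiplicativity at \<open>4 \<cdot> 9\<close>. Hence \<open>f(n) = n\<close>
  for squares and for all sums of \<open>k\<close> positive squares.

  If \<open>m\<close> is coprime to \<open>n\<close> and \<open>f\<close> fixes \<open>m\<close> and \<open>mn\<close>, then \<open>f(n) = n\<close>. For \<open>k \<ge> 5\<close> Lagrange's theorem
  makes every large number a sum of \<open>k\<close> positive squares, so any large \<open>m \<equiv> 1\<close> modulo \<open>n\<close> works. For
  \<open>k = 3, 4\<close>, by strong induction, only \<open>n = p\<^sup>e\<close> with \<open>e\<close> odd matters. A prime \<open>p > 5\<close> has a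
  multiple \<open>mp\<close> with \<open>m < p\<close> that is a sum of \<open>k\<close> positive squares, as in the first step of Lagrange's
  descent, and multiplying it by the square \<open>p\<^sup>e\<^sup>-\<^sup>1\<close> represents \<open>mp\<^sup>e\<close>.
\<close>

subsection \<open>Lagrange's four-square theorem\<close>

lemma symmetric_residue:
  fixes a m :: int
  assumes "odd m" "m > 0"
  obtains r where "m dvd a - r" "2 * \<bar>r\<bar> < m"
proof (cases "2 * (a mod m) < m")
  case True
  show ?thesis
    by (rule that[of "a mod m"]) (use True assms in \<open>auto simp: mod_eq_dvd_iff[symmetric]\<close>)
next
  case False
  have "a mod m < m" using assms by simp
  moreover have "m dvd a - (a mod m - m)"
    using dvd_add[OF _ dvd_refl, of m "a - a mod m"] by (simp add: algebra_simps)
  moreover have "2 * (a mod m) \<noteq> m" using assms(1) by (metis dvd_triv_left)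
  ultimately show ?thesis using False by (intro that[of "a mod m - m"]) auto
qed

text \<open>Oddness of \<open>m\<close> excludes the residue \<open>m/2\<close> and makes the bound
  strict; hence four such squares add up to less than \<open>m^2\<close>.\<close>

lemma symmetric_residue_square:
  fixes a m :: int
  assumes "odd m" "m > 0"
  obtains r where "m dvd a - r" "4 * r\<^sup>2 < m\<^sup>2"
proof -
  obtain r where r: "m dvd a - r" "2 * \<bar>r\<bar> < m"
    using symmetric_residue[OF assms] by blast
  have "(2 * \<bar>r\<bar>)\<^sup>2 < m\<^sup>2" using r(2) by (intro power_strict_mono) auto
  thus ?thesis using that r(1) by (simp add: power_mult_distrib)
qed

text \<open>Equal squares make \<open>p\<close> divide \<open>(x - y) * (x + y)\<close>, and both
  factors are smaller than \<open>p\<close> in absolute value.\<close>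

lemma inj_on_square_mod_prime:
  fixes p :: int
  assumes p: "prime p" "odd p"
  shows "inj_on (\<lambda>x. x\<^sup>2 mod p) {0..(p - 1) div 2}"
proof (rule inj_onI)
  fix x y assume x: "x \<in> {0..(p - 1) div 2}" and y: "y \<in> {0..(p - 1) div 2}"
    and "x\<^sup>2 mod p = y\<^sup>2 mod p"
  hence "p dvd (x - y) * (x + y)"
    by (simp add: mod_eq_dvd_iff power2_eq_square algebra_simps)
  moreover have "x + y < p" "\<bar>x - y\<bar> < p" using x y prime_gt_1_int[OF p(1)] by auto
  ultimately have "x + y \<le> 0 \<or> x - y = 0"
    using p(1) zdvd_imp_le[of p "x + y"] dvd_imp_le_int[of "x - y" p]
    by (force simp: prime_dvd_mult_iff)
  thus "x = y" using x y by auto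
qed

text \<open>Pigeonhole: the residues of \<open>x^2\<close> and those of \<open>-1 - y^2\<close> each
  number \<open>(p + 1) / 2\<close>, so the two sets meet.\<close>

lemma prime_dvd_two_squares_plus_one:
  fixes p :: int
  assumes p: "prime p" "odd p"
  obtains x y where "p dvd x\<^sup>2 + y\<^sup>2 + 1"
proof -
  define I where "I = {0..(p - 1) div 2}"
  define S where "S = (\<lambda>x. x\<^sup>2 mod p) ` I"
  define T where "T = (\<lambda>y. (- 1 - y) mod p) ` S"
  have pos: "p > 1" using p prime_gt_1_int by blast
  obtain q where q: "p = 2 * q + 1" using p(2) by (rule oddE)
  have cS: "int (card S) = q + 1"
    unfolding S_def I_def using inj_on_square_mod_prime[OF p] pos q by (subst card_image) auto
  have sub: "S \<subseteq> {0..<p}" "T \<subseteq> {0..<p}" unfolding S_def T_def using pos by auto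
  have "inj_on (\<lambda>y. (- 1 - y) mod p) {0..<p}"
  proof (rule inj_onI)
    fix x y assume xy: "x \<in> {0..<p}" "y \<in> {0..<p}" "(- 1 - x) mod p = (- 1 - y) mod p"
    hence "p dvd y - x" by (simp add: mod_eq_dvd_iff)
    thus "x = y" using xy(1,2) dvd_imp_le_int[of "y - x" p] by (cases "x = y") auto
  qed
  hence cT: "card T = card S" unfolding T_def
    using sub inj_on_subset card_image by blast
  have "S \<inter> T \<noteq> {}"
  proof
    assume "S \<inter> T = {}"
    moreover have "finite S" "finite T" "S \<union> T \<subseteq> {0..<p}"
      using sub finite_subset by blast+
    ultimately have "card S + card T \<le> card {0..<p}"
      by (metis card_Un_disjoint card_mono finite_atLeastLessThan_int)
    thus False using cS cT pos q by simp
  qed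
  then obtain x y where "x\<^sup>2 mod p = (- 1 - y\<^sup>2 mod p) mod p" unfolding S_def T_def by blast
  hence "x\<^sup>2 mod p = (- 1 - y\<^sup>2) mod p" by (simp add: mod_simps)
  hence "p dvd x\<^sup>2 + y\<^sup>2 + 1" by (simp add: mod_eq_dvd_iff algebra_simps)
  thus ?thesis using that by blast
qed

definition sum_of_four_squares :: "int \<Rightarrow> bool" where
  "sum_of_four_squares n \<longleftrightarrow> (\<exists>a b c d. n = a\<^sup>2 + b\<^sup>2 + c\<^sup>2 + d\<^sup>2)"

text \<open>Multiplicativity of the quaternion norm. The signs are such that, for
  \<open>(w, x, y, z)\<close> congruent to \<open>(a, b, c, d)\<close> modulo \<open>m\<close>, the
  last three entries on the right vanish modulo \<open>m\<close>.\<close>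

lemma euler_four_squares:
  fixes a b c d w x y z :: int
  shows "(a\<^sup>2 + b\<^sup>2 + c\<^sup>2 + d\<^sup>2) * (w\<^sup>2 + x\<^sup>2 + y\<^sup>2 + z\<^sup>2) =
    (a*w + b*x + c*y + d*z)\<^sup>2 + (a*x - b*w + c*z - d*y)\<^sup>2 +
    (a*y - b*z - c*w + d*x)\<^sup>2 + (a*z + b*y - c*x - d*w)\<^sup>2"
  by (simp add: power2_eq_square algebra_simps)

lemma sum_of_four_squares_mult:
  assumes "sum_of_four_squares m" "sum_of_four_squares n"
  shows "sum_of_four_squares (m * n)"
  using assms euler_four_squares unfolding sum_of_four_squares_def by metis

text \<open>An even sum lets the entries be paired by parity; each pair is then halved by
  \<open>(a^2 + b^2) / 2 = ((a + b) / 2)^2 + ((a - b) / 2)^2\<close>.\<close>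

lemma sum_of_four_squares_half:
  assumes "sum_of_four_squares (2 * n)"
  shows "sum_of_four_squares n"
proof -
  have *: "sum_of_four_squares n"
    if "2 * n = a\<^sup>2 + b\<^sup>2 + c\<^sup>2 + d\<^sup>2" "even (a + b)" "even (c + d)" for a b c d :: int
  proof -
    from that(2) obtain s where s: "a + b = 2 * s" by (rule evenE)
    from that(3) obtain t where t: "c + d = 2 * t" by (rule evenE)
    have ab: "b = 2 * s - a" "d = 2 * t - c" using s t by auto
    have "n = s\<^sup>2 + (a - s)\<^sup>2 + t\<^sup>2 + (c - t)\<^sup>2"
      using that(1) unfolding ab by (simp add: power2_eq_square algebra_simps)
    thus ?thesis unfolding sum_of_four_squares_def by blast
  qed
  obtain a b c d where n: "2 * n = a\<^sup>2 + b\<^sup>2 + c\<^sup>2 + d\<^sup>2"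
    using assms unfolding sum_of_four_squares_def by blast
  hence "even (a\<^sup>2 + b\<^sup>2 + c\<^sup>2 + d\<^sup>2)" by (metis dvd_triv_left)
  hence "even (a + b) \<and> even (c + d) \<or> even (a + c) \<and> even (b + d) \<or> even (a + d) \<and> even (b + c)"
    by auto
  thus ?thesis
    using *[of a b c d] *[of a c b d] *[of a d b c] n by (auto simp: algebra_simps)
qed

text \<open>Even \<open>m\<close> is halved. For odd \<open>m\<close>, the entries are reduced
  modulo \<open>m\<close> to squares with sum \<open>m * r\<close>, \<open>r < m\<close>; Euler's
  product of the two sums has entries divisible by \<open>m\<close>, and dividing by
  \<open>m^2\<close> leaves \<open>r * p\<close>.\<close>

lemma sum_of_four_squares_descent:
  assumes p: "prime p" and m: "1 < m" "m < p" and rep: "sum_of_four_squares (m * p)"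
  obtains m' where "0 < m'" "m' < m" "sum_of_four_squares (m' * p)"
proof (cases "even m")
  case True
  then obtain q where "m = 2 * q" by auto
  thus ?thesis using that[of q] m rep sum_of_four_squares_half[of "q * p"]
    by (simp add: mult.assoc)
next
  case False
  obtain a b c d where mp: "m * p = a\<^sup>2 + b\<^sup>2 + c\<^sup>2 + d\<^sup>2"
    using rep unfolding sum_of_four_squares_def by blast
  have m0: "odd m" "m > 0" using False m by auto
  obtain w where w: "m dvd a - w" "4 * w\<^sup>2 < m\<^sup>2" using symmetric_residue_square[OF m0] by blast
  obtain x where x: "m dvd b - x" "4 * x\<^sup>2 < m\<^sup>2" using symmetric_residue_square[OF m0] by blast
  obtain y where y: "m dvd c - y" "4 * y\<^sup>2 < m\<^sup>2" using symmetric_residue_square[OF m0] by blast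
  obtain z where z: "m dvd d - z" "4 * z\<^sup>2 < m\<^sup>2" using symmetric_residue_square[OF m0] by blast
  obtain a' where a': "a = w + m * a'" using w(1) by (metis diff_add_cancel add.commute dvdE)
  obtain b' where b': "b = x + m * b'" using x(1) by (metis diff_add_cancel add.commute dvdE)
  obtain c' where c': "c = y + m * c'" using y(1) by (metis diff_add_cancel add.commute dvdE)
  obtain d' where d': "d = z + m * d'" using z(1) by (metis diff_add_cancel add.commute dvdE)
  \<comment> \<open>Obtained by substituting \<open>a = w + m * a'\<close> and its analogues into
    the representation of \<open>m * p\<close> and dividing by \<open>m\<close>.\<close>
  define r where "r = p - 2 * (w*a' + x*b' + y*c' + z*d') - m * (a'\<^sup>2 + b'\<^sup>2 + c'\<^sup>2 + d'\<^sup>2)"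
  have mr: "w\<^sup>2 + x\<^sup>2 + y\<^sup>2 + z\<^sup>2 = m * r"
    using mp unfolding a' b' c' d' r_def by (simp add: power2_eq_square algebra_simps)
  have "m * r < m * m" using w x y z mr by (simp add: power2_eq_square)
  hence rm: "r < m" using m by simp
  have "m * r \<ge> 0" unfolding mr[symmetric] by simp
  hence r0: "r \<ge> 0" using m by (simp add: zero_le_mult_iff)
  \<comment> \<open>Otherwise all four residues vanish, \<open>m^2\<close> divides
    \<open>m * p\<close>, and \<open>m\<close> is a proper divisor of the prime
    \<open>p\<close>.\<close>
  have "r \<noteq> 0"
  proof
    assume "r = 0"
    hence "w\<^sup>2 + x\<^sup>2 + y\<^sup>2 + z\<^sup>2 = 0" using mr by simp
    hence "w = 0" "x = 0" "y = 0" "z = 0"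
      by (auto simp: add_nonneg_eq_0_iff)
    hence "m * p = m * (m * (a'\<^sup>2 + b'\<^sup>2 + c'\<^sup>2 + d'\<^sup>2))"
      using mp unfolding a' b' c' d' by (simp add: power2_eq_square algebra_simps)
    hence "m dvd p" using m by simp
    moreover have "0 \<le> m" using m by simp
    ultimately have "m = 1 \<or> m = p" using p unfolding prime_int_iff by blast
    thus False using m by simp
  qed
  define A B C D where "A = w*a' + x*b' + y*c' + z*d' + r"
    and "B = a'*x - b'*w + c'*z - d'*y"
    and "C = a'*y - b'*z - c'*w + d'*x"
    and "D = a'*z + b'*y - c'*x - d'*w"
  have "m * m * (r * p) = (m * p) * (m * r)" by simp
  also have "\<dots> = (a*w + b*x + c*y + d*z)\<^sup>2 + (a*x - b*w + c*z - d*y)\<^sup>2 +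
    (a*y - b*z - c*w + d*x)\<^sup>2 + (a*z + b*y - c*x - d*w)\<^sup>2"
    unfolding mp mr[symmetric] by (rule euler_four_squares)
  also have "a*w + b*x + c*y + d*z = (w\<^sup>2 + x\<^sup>2 + y\<^sup>2 + z\<^sup>2) + m * (w*a' + x*b' + y*c' + z*d')"
    unfolding a' b' c' d' by (simp add: power2_eq_square algebra_simps)
  also have "\<dots> = m * A" unfolding mr A_def by (simp add: algebra_simps)
  also have "a*x - b*w + c*z - d*y = m * B" unfolding a' b' c' d' B_def by (simp add: algebra_simps)
  also have "a*y - b*z - c*w + d*x = m * C" unfolding a' b' c' d' C_def by (simp add: algebra_simps)
  also have "a*z + b*y - c*x - d*w = m * D" unfolding a' b' c' d' D_def by (simp add: algebra_simps)
  also have "(m*A)\<^sup>2 + (m*B)\<^sup>2 + (m*C)\<^sup>2 + (m*D)\<^sup>2 = m * m * (A\<^sup>2 + B\<^sup>2 + C\<^sup>2 + D\<^sup>2)"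
    by (simp add: power2_eq_square algebra_simps)
  finally have "r * p = A\<^sup>2 + B\<^sup>2 + C\<^sup>2 + D\<^sup>2" using m by simp
  hence "sum_of_four_squares (r * p)" unfolding sum_of_four_squares_def by blast
  thus ?thesis by (intro that[of r]) (use rm r0 \<open>r \<noteq> 0\<close> in auto)
qed

lemma sum_of_four_squares_prime:
  assumes p: "prime p"
  shows "sum_of_four_squares p"
proof (cases "odd p")
  case False
  hence "p = 2" using p by (auto simp: prime_int_iff dest: spec[of _ 2])
  hence "p = 1\<^sup>2 + 1\<^sup>2 + 0\<^sup>2 + 0\<^sup>2" by simp
  thus ?thesis unfolding sum_of_four_squares_def by blast
next
  case True
  have p1: "p > 1" using p prime_gt_1_int by blast
  hence p0: "p > 0" by simp
  obtain x0 y0 where xy0: "p dvd x0\<^sup>2 + y0\<^sup>2 + 1" using prime_dvd_two_squares_plus_one[OF p True] by blast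
  obtain x where x: "p dvd x0 - x" "4 * x\<^sup>2 < p\<^sup>2" using symmetric_residue_square[OF True p0] by blast
  obtain y where y: "p dvd y0 - y" "4 * y\<^sup>2 < p\<^sup>2" using symmetric_residue_square[OF True p0] by blast
  have "x\<^sup>2 + y\<^sup>2 + 1 = (x0\<^sup>2 + y0\<^sup>2 + 1) - (x0 - x) * (x0 + x) - (y0 - y) * (y0 + y)"
    by (simp add: power2_eq_square algebra_simps)
  moreover have "p dvd (x0\<^sup>2 + y0\<^sup>2 + 1) - (x0 - x) * (x0 + x) - (y0 - y) * (y0 + y)"
    by (rule dvd_diff[OF dvd_diff[OF xy0 dvd_mult2[OF x(1)]] dvd_mult2[OF y(1)]])
  ultimately have "p dvd x\<^sup>2 + y\<^sup>2 + 1" by metis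
  then obtain m where m: "x\<^sup>2 + y\<^sup>2 + 1 = m * p" by (metis dvdE mult.commute)
  \<comment> \<open>The summand 1 is at most \<open>p^2 / 4\<close>, and \<open>x^2 + y^2\<close> is
    below \<open>p^2 / 2\<close>.\<close>
  have "2 * 2 \<le> p * p" using p1 by (intro mult_mono) auto
  hence "m * p < p * p" using x(2) y(2) unfolding m[symmetric] power2_eq_square by linarith
  hence mp: "m < p" using p1 by simp
  have "0 < m * p" unfolding m[symmetric] by (simp add: add_nonneg_pos)
  hence m0: "m > 0" using p1 by (simp add: zero_less_mult_iff)
  have "m * p = x\<^sup>2 + y\<^sup>2 + 1\<^sup>2 + 0\<^sup>2" using m by simp
  hence "sum_of_four_squares (m * p)" unfolding sum_of_four_squares_def by blast
  with m0 mp show ?thesis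
  proof (induction "nat m" arbitrary: m rule: less_induct)
    case less
    show ?case
    proof (cases "m = 1")
      case False
      hence "1 < m" using less.prems(1) by simp
      then obtain m' where "0 < m'" "m' < m" "sum_of_four_squares (m' * p)"
        using sum_of_four_squares_descent[OF p _ less.prems(2,3)] by blast
      thus ?thesis using less.hyps[of m'] less.prems by simp
    qed (use less in simp)
  qed
qed

theorem sum_of_four_squares_nat: "sum_of_four_squares (int n)"
proof (induction n rule: less_induct)
  case (less n)
  show ?case
  proof (cases "n \<le> 1")
    case True
    hence "int n = (int n)\<^sup>2 + 0\<^sup>2 + 0\<^sup>2 + 0\<^sup>2" by (cases n) auto
    thus ?thesis unfolding sum_of_four_squares_def by blast
  next
    case False
    then obtain p q where pq: "prime p" "n = p * q" using prime_factor_nat[of n] by (auto elim: dvdE)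
    moreover from this have "q < n" using False prime_gt_1_nat by (cases "q = 0") auto
    ultimately have "sum_of_four_squares (int p * int q)"
      using less pq sum_of_four_squares_mult sum_of_four_squares_prime[of "int p"] by auto
    thus ?thesis using pq by simp
  qed
qed

subsection \<open>Sums of a fixed number of positive squares\<close>

text \<open>Lists allow explicit witnesses for numerals and padding by appended ones.\<close>

definition sums_of_positive_squares :: "nat \<Rightarrow> nat set" where
  "sums_of_positive_squares k =
     {n. \<exists>xs. length xs = k \<and> (\<forall>x\<in>set xs. 0 < x) \<and> n = (\<Sum>x\<leftarrow>xs. x\<^sup>2)}"

lemma sum_list_in_sums_of_positive_squares:
  assumes "length xs = k" "\<And>x. x \<in> set xs \<Longrightarrow> 0 < x" "n = (\<Sum>x\<leftarrow>xs. x\<^sup>2)"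
  shows "n \<in> sums_of_positive_squares k"
  using assms unfolding sums_of_positive_squares_def by blast

lemma sums_of_positive_squares_scale:
  assumes "n \<in> sums_of_positive_squares k" "t > 0"
  shows "t\<^sup>2 * n \<in> sums_of_positive_squares k"
proof -
  obtain xs where xs: "length xs = k" "\<forall>x\<in>set xs. 0 < x" "n = (\<Sum>x\<leftarrow>xs. x\<^sup>2)"
    using assms(1) unfolding sums_of_positive_squares_def by blast
  show ?thesis
    using xs assms(2)
    by (intro sum_list_in_sums_of_positive_squares[of "map ((*) t) xs"])
       (auto simp: o_def power_mult_distrib sum_list_const_mult)
qed

lemma at_most_four_positive_squares:
  assumes "n > 0"
  obtains xs :: "nat list" where "length xs \<in> {1..4}" "\<And>x. x \<in> set xs \<Longrightarrow> 0 < x"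
    "n = (\<Sum>x\<leftarrow>xs. x\<^sup>2)"
proof -
  obtain a b c d where n: "int n = a\<^sup>2 + b\<^sup>2 + c\<^sup>2 + d\<^sup>2"
    using sum_of_four_squares_nat[of n] unfolding sum_of_four_squares_def by blast
  define ys where "ys = [nat \<bar>a\<bar>, nat \<bar>b\<bar>, nat \<bar>c\<bar>, nat \<bar>d\<bar>]"
  define xs where "xs = filter (\<lambda>x. x > 0) ys"
  have "(\<Sum>x\<leftarrow>xs. x\<^sup>2) = (\<Sum>x\<leftarrow>ys. x\<^sup>2)"
    unfolding xs_def by (intro sum_list_map_filter) auto
  moreover have "int (\<Sum>x\<leftarrow>ys. x\<^sup>2) = int n" unfolding ys_def n by simp
  ultimately have sum: "n = (\<Sum>x\<leftarrow>xs. x\<^sup>2)" by simp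
  have "length xs \<le> length ys" unfolding xs_def by (rule length_filter_le)
  hence "length xs \<le> 4" unfolding ys_def by simp
  moreover have "xs \<noteq> []" using sum assms by auto
  ultimately have "length xs \<in> {1..4}" by (cases xs) auto
  thus ?thesis by (rule that[of xs]) (use sum xs_def in auto)
qed

text \<open>The number \<open>169\<close> is a sum of \<open>j\<close> positive squares for each \<open>j = 1, \<dots>, 4\<close>, so adding it
  to a sum of at most four positive squares allows one to bring their number to exactly five.\<close>

lemma large_in_sums_of_positive_squares:
  assumes k: "k \<ge> 5" and n: "n \<ge> 165 + k"
  shows "n \<in> sums_of_positive_squares k"
proof -
  \<comment> \<open>Here \<open>164 + k = 169 + (k - 5)\<close>: the block 169 completes five
    squares, and \<open>k - 5\<close> ones follow.\<close>
  have "n - (164 + k) > 0" using n by simp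
  then obtain xs where xs: "length xs \<in> {1..4}" "\<And>x. x \<in> set xs \<Longrightarrow> 0 < x"
    "n - (164 + k) = (\<Sum>x\<leftarrow>xs. x\<^sup>2)"
    using at_most_four_positive_squares by metis
  have "\<exists>ys :: nat list. length ys = 5 - length xs \<and> (\<forall>y\<in>set ys. 0 < y) \<and> (\<Sum>y\<leftarrow>ys. y\<^sup>2) = 169"
  proof -
    consider "length xs = 4" | "length xs = 3" | "length xs = 2" | "length xs = 1"
      using xs(1) by force
    thus ?thesis
    proof cases
      case 1 thus ?thesis by (intro exI[of _ "[13]"]) simp
    next
      case 2 thus ?thesis by (intro exI[of _ "[12, 5]"]) simp
    next
      case 3 thus ?thesis by (intro exI[of _ "[12, 4, 3]"]) simp
    next
      case 4 thus ?thesis by (intro exI[of _ "[10, 8, 2, 1]"]) simp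
    qed
  qed
  then obtain ys where ys: "length ys = 5 - length xs" "\<And>y. y \<in> set ys \<Longrightarrow> (0::nat) < y"
    "(\<Sum>y\<leftarrow>ys. y\<^sup>2) = 169" by blast
  have "n = 169 + (\<Sum>x\<leftarrow>xs. x\<^sup>2) + (k - 5)" using xs(3) n k by simp
  thus ?thesis
    using xs ys k
    by (intro sum_list_in_sums_of_positive_squares[of "xs @ ys @ replicate (k - 5) 1"])
       (auto simp: sum_list_replicate)
qed

section \<open>Small multiples of a prime as sums of positive squares\<close>

text \<open>Entries prime to \<open>p\<close> reduce to nonzero residues, hence to positive squares.
  The relation \<open>p dvd x^2 + y^2 + 1\<close> serves unless \<open>p\<close> divides
  \<open>x\<close> or \<open>y\<close>; then -1 is a square modulo \<open>p\<close>, and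
  \<open>p > 5\<close> makes 3, 4 and 5 units.\<close>

lemma prime_dvd_sum_of_three_nonzero_squares:
  fixes p :: int
  assumes p: "prime p" "p > 5"
  obtains x y z where "p dvd x\<^sup>2 + y\<^sup>2 + z\<^sup>2" "\<not> p dvd x" "\<not> p dvd y" "\<not> p dvd z"
proof -
  have "odd p" using p prime_odd_int by force
  then obtain x y where xy: "p dvd x\<^sup>2 + y\<^sup>2 + 1"
    using prime_dvd_two_squares_plus_one p(1) by blast
  have small: "\<not> p dvd c" if "0 < c" "c \<le> 5" for c using that p zdvd_not_zless by simp
  note rep = that
  \<comment> \<open>if one of the squares vanishes modulo \<open>p\<close>, split \<open>5\<^sup>2 z\<^sup>2\<close> as \<open>(3z)\<^sup>2 + (4z)\<^sup>2\<close>\<close>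
  have *: thesis if z: "p dvd z\<^sup>2 + 1" for z
  proof (rule rep)
    have "\<not> p dvd z"
    proof
      assume "p dvd z"
      hence "p dvd z\<^sup>2" by (simp add: power2_eq_square)
      hence "p dvd 1" using z by (simp add: dvd_add_right_iff)
      thus False using p by simp
    qed
    thus "\<not> p dvd 3 * z" "\<not> p dvd 4 * z" using small p by (simp_all add: prime_dvd_mult_iff)
    show "\<not> p dvd 5" using small by simp
    have "(3 * z)\<^sup>2 + (4 * z)\<^sup>2 + 5\<^sup>2 = 25 * (z\<^sup>2 + 1)" by (simp add: power_mult_distrib)
    thus "p dvd (3 * z)\<^sup>2 + (4 * z)\<^sup>2 + 5\<^sup>2" using z by (metis dvd_mult)
  qed
  consider "p dvd x" | "p dvd y" | "\<not> p dvd x" "\<not> p dvd y" by blast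
  thus ?thesis
  proof cases
    case 1
    hence "p dvd x\<^sup>2" by (simp add: power2_eq_square)
    hence "p dvd y\<^sup>2 + 1" using xy by (simp add: dvd_add_right_iff add.assoc)
    thus ?thesis by (rule *)
  next
    case 2
    hence "p dvd y\<^sup>2" by (simp add: power2_eq_square)
    hence "p dvd x\<^sup>2 + 1" using xy
      by (metis add.assoc add.commute dvd_add_right_iff)
    thus ?thesis by (rule *)
  next
    case 3
    show ?thesis by (rule that[of x y 1]) (use 3 xy p in auto)
  qed
qed

text \<open>Absolute least residues are positive and below \<open>p / 2\<close>, so at most four of
  their squares sum to a positive multiple of \<open>p\<close> less than \<open>p^2\<close>.\<close>

lemma sum_of_squares_mod_prime_reduce:
  fixes p :: nat and xs :: "int list"
  assumes p: "odd p" and xs: "xs \<noteq> []" "length xs \<le> 4" "\<And>x. x \<in> set xs \<Longrightarrow> \<not> int p dvd x"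
    and sum: "int p dvd (\<Sum>x\<leftarrow>xs. x\<^sup>2)"
  obtains m where "0 < m" "m < p" "m * p \<in> sums_of_positive_squares (length xs)"
proof -
  have p0: "odd (int p)" "int p > 0" using p by (auto intro: Nat.gr0I)
  have "\<exists>y. \<not> int p dvd x \<longrightarrow> 0 < y \<and> 4 * y\<^sup>2 < p\<^sup>2 \<and> int p dvd x\<^sup>2 - (int y)\<^sup>2" for x
  proof -
    obtain r where r: "int p dvd x - r" "4 * r\<^sup>2 < (int p)\<^sup>2"
      using symmetric_residue_square[OF p0] by blast
    have "x\<^sup>2 - r\<^sup>2 = (x - r) * (x + r)" by (simp add: power2_eq_square algebra_simps)
    hence "int p dvd x\<^sup>2 - (int (nat \<bar>r\<bar>))\<^sup>2" using r(1) by simp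
    moreover have "int (4 * (nat \<bar>r\<bar>)\<^sup>2) < int (p\<^sup>2)" using r(2) by simp
    hence "4 * (nat \<bar>r\<bar>)\<^sup>2 < p\<^sup>2" by (subst (asm) of_nat_less_iff)
    moreover have "0 < nat \<bar>r\<bar>" if "\<not> int p dvd x" using that r(1) by auto
    ultimately show ?thesis by blast
  qed
  then obtain h where h: "\<And>x. \<not> int p dvd x \<Longrightarrow> 0 < h x"
    "\<And>x. \<not> int p dvd x \<Longrightarrow> 4 * (h x)\<^sup>2 < p\<^sup>2"
    "\<And>x. \<not> int p dvd x \<Longrightarrow> int p dvd x\<^sup>2 - (int (h x))\<^sup>2" by metis
  define n where "n = (\<Sum>x\<leftarrow>map h xs. x\<^sup>2)"
  have n: "n \<in> sums_of_positive_squares (length xs)"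
    unfolding n_def using h(1) xs(3)
    by (intro sum_list_in_sums_of_positive_squares[of "map h xs"]) auto
  have "int p dvd (\<Sum>x\<leftarrow>xs. x\<^sup>2) - int n"
    unfolding n_def using xs(3)
  proof (induction xs)
    case (Cons x xs)
    hence "int p dvd (x\<^sup>2 - (int (h x))\<^sup>2) + ((\<Sum>x\<leftarrow>xs. x\<^sup>2) - int (\<Sum>x\<leftarrow>map h xs. x\<^sup>2))"
      by (intro dvd_add h(3)) auto
    thus ?case by (simp add: algebra_simps)
  qed simp
  hence "int p dvd int n" using sum dvd_diff_right_iff by blast
  then obtain m where m: "n = m * p" by (metis dvdE int_dvd_int_iff mult.commute)
  have "4 * n < length xs * p\<^sup>2"
    unfolding n_def using xs(1,3)
  proof (induction xs rule: list_nonempty_induct)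
    case (single x) thus ?case using h(2) by simp
  next
    case (cons x xs)
    hence "4 * (\<Sum>x\<leftarrow>map h xs. x\<^sup>2) < length xs * p\<^sup>2" "4 * (h x)\<^sup>2 < p\<^sup>2" using h(2) by auto
    thus ?case by (simp add: algebra_simps)
  qed
  also have "\<dots> \<le> 4 * p\<^sup>2" using xs(2) by simp
  finally have "m * p < p * p" unfolding m power2_eq_square by simp
  hence "m < p" by simp
  moreover have "m > 0"
  proof (rule Nat.gr0I)
    assume "m = 0"
    hence "(\<Sum>x\<leftarrow>map h xs. x\<^sup>2) = 0" using m n_def by simp
    thus False using xs(1,3) h(1)[of "hd xs"] by (cases xs) auto
  qed
  ultimately show ?thesis using that n m by simp
qed

lemma prime_multiple_in_sums_of_positive_squares:
  fixes p :: nat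
  assumes p: "prime p" "p > 5" and k: "k = 3 \<or> k = 4"
  obtains m where "0 < m" "m < p" "m * p \<in> sums_of_positive_squares k"
proof -
  have p': "prime (int p)" "int p > 5" using p by auto
  have odd: "odd p" using p prime_odd_nat by force
  obtain x y z where xyz: "int p dvd x\<^sup>2 + y\<^sup>2 + z\<^sup>2"
      "\<not> int p dvd x" "\<not> int p dvd y" "\<not> int p dvd z"
    using prime_dvd_sum_of_three_nonzero_squares[OF p'] by blast
  from k show ?thesis
  proof
    assume "k = 3"
    have "int p dvd (\<Sum>x\<leftarrow>[x, y, z]. x\<^sup>2)" using xyz(1) by (simp add: add.assoc)
    moreover have "\<not> int p dvd a" if "a \<in> set [x, y, z]" for a using that xyz by auto
    ultimately obtain m where "0 < m" "m < p" "m * p \<in> sums_of_positive_squares (length [x, y, z])"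
      using sum_of_squares_mod_prime_reduce[OF odd, of "[x, y, z]"] by auto
    thus ?thesis using that[of m] \<open>k = 3\<close> by (simp add: eval_nat_numeral)
  next
    assume "k = 4"
    have small: "\<not> int p dvd c" if "0 < c" "c \<le> 5" for c using that p zdvd_not_zless by simp
    \<comment> \<open>A fourth entry arises by scaling with 25 and splitting \<open>25 * z^2\<close>
      as \<open>9 * z^2 + 16 * z^2\<close>.\<close>
    let ?xs = "[5 * x, 5 * y, 3 * z, 4 * z]"
    have "(\<Sum>x\<leftarrow>?xs. x\<^sup>2) = 25 * (x\<^sup>2 + y\<^sup>2 + z\<^sup>2)"
      by (simp add: power_mult_distrib)
    hence "int p dvd (\<Sum>x\<leftarrow>?xs. x\<^sup>2)" using xyz(1) by (metis dvd_mult)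
    moreover have "\<not> int p dvd a" if "a \<in> set ?xs" for a
      using that xyz small p'(1) by (auto simp: prime_dvd_mult_iff)
    ultimately obtain m where "0 < m" "m < p" "m * p \<in> sums_of_positive_squares (length ?xs)"
      using sum_of_squares_mod_prime_reduce[OF odd, of ?xs] by auto
    thus ?thesis using that[of m] \<open>k = 4\<close> by (simp add: eval_nat_numeral)
  qed
qed

subsection \<open>Multiplicative functions additive on squares\<close>

text \<open>A sum of three squares modulo 4 counts its odd entries, so the parity indicator respects
  exchanges just as \<open>a^2\<close> and constants do. Subtracting the combination
  \<open>q\<close> that agrees with \<open>g\<close> at 1, 2, 3 leaves \<open>D\<close>, which
  identities between sums of squares force to vanish everywhere.\<close>

lemma quadratic_of_exchange:
  fixes g :: "nat \<Rightarrow> complex"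
  assumes exchange: "\<And>a b c d e h. \<lbrakk>0 < a; 0 < b; 0 < c; 0 < d; 0 < e; 0 < h;
      a\<^sup>2 + b\<^sup>2 + c\<^sup>2 = d\<^sup>2 + e\<^sup>2 + h\<^sup>2\<rbrakk> \<Longrightarrow> g a + g b + g c = g d + g e + g h"
  obtains A B C where "\<And>a. 0 < a \<Longrightarrow> g a = A * (of_nat a)\<^sup>2 + B + (if odd a then C else 0)"
proof -
  define A where "A = (g 3 - g 1) / 8"
  define B where "B = g 2 - 4 * A"
  define C where "C = g 1 - A - B"
  define q where "q a = A * (of_nat a)\<^sup>2 + B + (if odd a then C else 0)" for a :: nat
  define D where "D a = g a - q a" for a
  have D: "D a + D b + D c = D d + D e + D h"
    if "0 < a" "0 < b" "0 < c" "0 < d" "0 < e" "0 < h" "a\<^sup>2 + b\<^sup>2 + c\<^sup>2 = d\<^sup>2 + e\<^sup>2 + h\<^sup>2"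
      and par: "q a + q b + q c = q d + q e + q h" for a b c d e h
  proof -
    have "D a + D b + D c = (g a + g b + g c) - (q a + q b + q c)" by (simp add: D_def)
    also have "\<dots> = (g d + g e + g h) - (q d + q e + q h)"
      unfolding par using exchange[OF that(1-7)] by simp
    finally show ?thesis by (simp add: D_def)
  qed
  have D123: "D 1 = 0" "D 2 = 0" "D 3 = 0" by (simp_all add: D_def q_def A_def B_def C_def field_simps)
  \<comment> \<open>Each of these identities, starting with
    \<open>27 = 9 + 9 + 9 = 1 + 1 + 25\<close>, brings in a single new argument.\<close>
  have D5: "D 5 = 0" using D[of 3 3 3 1 1 5] D123 by (simp add: q_def)
  have D4: "D 4 = 0" using D[of 4 4 1 2 2 5] D123 D5 by (simp add: q_def)
  have D6: "D 6 = 0" using D[of 6 2 1 4 4 3] D123 D4 by (simp add: q_def)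
  have D7: "D 7 = 0" using D[of 7 1 1 5 5 1] D123 D5 by (simp add: q_def)
  have D8: "D 8 = 0" using D[of 8 1 1 5 5 4] D123 D4 D5 by (simp add: q_def)
  have D10: "D 10 = 0" using D[of 10 1 1 7 7 2] D123 D7 by (simp add: q_def)
  have "D a = 0" if "0 < a" for a
    using that
  proof (induction a rule: less_induct)
    case (less a)
    show ?case
    \<comment> \<open>From these thresholds on, the smallest entry of the recursion used,
      \<open>x - 2\<close> for odd and \<open>x - 4\<close> for even \<open>a\<close>, is positive.
      An extra 1 on both sides supplies the third square.\<close>
    proof (cases "odd a \<and> a \<ge> 7 \<or> a \<ge> 12")
      case False
      hence "a = 1 \<or> a = 2 \<or> a = 3 \<or> a = 4 \<or> a = 5 \<or> a = 6 \<or> a = 8 \<or> a = 10"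
        using less.prems by presburger
      thus ?thesis using D123 D4 D5 D6 D8 D10 by auto
    next
      case True
      show ?thesis
      proof (cases "odd a")
        case odd: True
        hence "a \<ge> 7" using True by auto
        obtain x where "a = 2 * x + 1" using odd by (rule oddE)
        moreover define y where "y = x - 3"
        ultimately have a: "a = 2 * y + 7" using \<open>a \<ge> 7\<close> by simp
        \<comment> \<open>\<open>(2x + 1)\<^sup>2 + (x - 2)\<^sup>2 = (2x - 1)\<^sup>2 + (x + 2)\<^sup>2\<close> with \<open>x = y + 3\<close>\<close>
        have "D a + D (y + 1) + D 1 = D (2 * y + 5) + D (y + 5) + D 1"
          by (rule D) (auto simp: a q_def power2_eq_square algebra_simps)
        thus ?thesis using less.IH[of "y + 1"] less.IH[of "2 * y + 5"] less.IH[of "y + 5"] a by simp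
      next
        case False
        hence "a \<ge> 12" using True by auto
        obtain x where "a = 2 * x" using False by auto
        moreover define y where "y = x - 6"
        ultimately have a: "a = 2 * y + 12" using \<open>a \<ge> 12\<close> by simp
        \<comment> \<open>\<open>(2x + 2)\<^sup>2 + (x - 4)\<^sup>2 = (2x - 2)\<^sup>2 + (x + 4)\<^sup>2\<close> with \<open>x = y + 5\<close>\<close>
        have "D a + D (y + 1) + D 1 = D (2 * y + 8) + D (y + 9) + D 1"
          by (rule D) (auto simp: a q_def power2_eq_square algebra_simps)
        thus ?thesis using less.IH[of "y + 1"] less.IH[of "2 * y + 8"] less.IH[of "y + 9"] a by simp
      qed
    qed
  qed
  thus ?thesis using that[of A B C] by (simp add: D_def q_def)
qed

section \<open>Values at squares\<close>

locale additive_on_squares =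
  fixes k :: nat and f :: "nat \<Rightarrow> complex"
  assumes k: "k \<ge> 3"
    and one: "f 1 = 1"
    and mult: "\<And>m n. 0 < m \<Longrightarrow> 0 < n \<Longrightarrow> coprime m n \<Longrightarrow> f (m * n) = f m * f n"
    and additive: "\<And>xs. length xs = k \<Longrightarrow> (\<And>x. x \<in> set xs \<Longrightarrow> 0 < x) \<Longrightarrow>
        f (\<Sum>x\<leftarrow>xs. x\<^sup>2) = (\<Sum>x\<leftarrow>xs. f (x\<^sup>2))"
begin

text \<open>Padding both lists with the same ones gives two representations of one number by
  \<open>k\<close> squares; the values at the ones cancel.\<close>

lemma exchange:
  assumes "length xs = length ys" "length xs \<le> k" "\<And>x. x \<in> set (xs @ ys) \<Longrightarrow> 0 < x"
    "(\<Sum>x\<leftarrow>xs. x\<^sup>2) = (\<Sum>y\<leftarrow>ys. y\<^sup>2)"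
  shows "(\<Sum>x\<leftarrow>xs. f (x\<^sup>2)) = (\<Sum>y\<leftarrow>ys. f (y\<^sup>2))"
proof -
  define zs :: "nat list" where "zs = replicate (k - length xs) 1"
  have "f (\<Sum>x\<leftarrow>xs @ zs. x\<^sup>2) = (\<Sum>x\<leftarrow>xs @ zs. f (x\<^sup>2))"
    by (rule additive) (use assms in \<open>auto simp: zs_def\<close>)
  moreover have "f (\<Sum>x\<leftarrow>ys @ zs. x\<^sup>2) = (\<Sum>x\<leftarrow>ys @ zs. f (x\<^sup>2))"
    by (rule additive) (use assms in \<open>auto simp: zs_def\<close>)
  ultimately show ?thesis using assms(4) by simp
qed

lemma square_values_quadratic:
  obtains A B C where "\<And>a. 0 < a \<Longrightarrow> f (a\<^sup>2) = A * (of_nat a)\<^sup>2 + B + (if odd a then C else 0)"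
    "A + B + C = 1" "A = 0 \<or> A = 1" "k \<ge> 4 \<Longrightarrow> C = 0"
proof -
  obtain A B C where q: "\<And>a. 0 < a \<Longrightarrow> f (a\<^sup>2) = A * (of_nat a)\<^sup>2 + B + (if odd a then C else 0)"
  proof (rule quadratic_of_exchange[of "\<lambda>a. f (a\<^sup>2)"])
    fix a b c d e h :: nat
    assume "0 < a" "0 < b" "0 < c" "0 < d" "0 < e" "0 < h" "a\<^sup>2 + b\<^sup>2 + c\<^sup>2 = d\<^sup>2 + e\<^sup>2 + h\<^sup>2"
    thus "f (a\<^sup>2) + f (b\<^sup>2) + f (c\<^sup>2) = f (d\<^sup>2) + f (e\<^sup>2) + f (h\<^sup>2)"
      using exchange[of "[a, b, c]" "[d, e, h]"] k by (auto simp: add.assoc)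
  qed blast
  have sum: "A + B + C = 1" using q[of 1] one by simp
  \<comment> \<open>Both squares and their product are odd, so only \<open>B + C = 1 - A\<close>
    enters besides \<open>A\<close>, leaving a quadratic equation in \<open>A\<close>.\<close>
  have "coprime (9 :: nat) 25" by (simp add: coprime_iff_gcd_eq_1 gcd_nat.simps)
  hence "f (3\<^sup>2 * 5\<^sup>2) = f (3\<^sup>2) * f (5\<^sup>2)" by (intro mult) auto
  moreover have "(3\<^sup>2 * 5\<^sup>2 :: nat) = 15\<^sup>2" by simp
  ultimately have "225 * A + (B + C) = (9 * A + (B + C)) * (25 * A + (B + C))"
    using q[of 3] q[of 5] q[of 15] by (simp add: add.assoc mult.commute)
  moreover have BC: "B + C = 1 - A" using sum by (simp add: algebra_simps)
  ultimately have "192 * (A * (A - 1)) = 0" unfolding BC by (simp add: algebra_simps)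
  hence A: "A = 0 \<or> A = 1" by simp
  have "C = 0" if "k \<ge> 4"
  proof -
    \<comment> \<open>Both sides represent 28, once by odd and once by even squares; the difference
      in values is \<open>4 * C\<close>.\<close>
    have "(\<Sum>x\<leftarrow>[1, 1, 1, 5]. f (x\<^sup>2)) = (\<Sum>x\<leftarrow>[2, 2, 2, 4]. f (x\<^sup>2))"
      using that by (intro exchange) auto
    thus ?thesis using q[of 1] q[of 5] q[of 2] q[of 4] by simp
  qed
  thus ?thesis using that q sum A by blast
qed

text \<open>This is the case \<open>A = 0\<close> for three squares. From
  \<open>9 = 1 + 4 + 4\<close> follows \<open>B = 0\<close>, so a sum of three positive squares
  takes as value its number of odd entries. Then 3, 6 and 14 give \<open>f 7 = 3\<close>, and
  \<open>21 = 3 * 7\<close> would have value 9 instead of 1.\<close>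

lemma not_one_on_odd_squares:
  assumes k3: "k = 3" and q: "\<And>a. 0 < a \<Longrightarrow> f (a\<^sup>2) = (if odd a then 1 else B)"
  shows False
proof -
  have add3: "f (a\<^sup>2 + b\<^sup>2 + c\<^sup>2) = f (a\<^sup>2) + f (b\<^sup>2) + f (c\<^sup>2)" if "0 < a" "0 < b" "0 < c" for a b c
    using additive[of "[a, b, c]"] k3 that by (auto simp: add.assoc)
  have f3: "f 3 = 3" using add3[of 1 1 1] q[of 1] by (simp add: numeral_3_eq_3)
  have "f 9 = 1 + 2 * B" using add3[of 1 2 2] q[of 1] q[of 2] by simp
  hence B: "B = 0" using q[of 3] by simp
  have "f 6 = 2" using add3[of 1 1 2] q[of 1] q[of 2] B by simp
  hence f2: "f 2 * 3 = 2" using mult[of 2 3] f3 by simp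
  have "f 14 = 2" using add3[of 1 2 3] q[of 1] q[of 2] q[of 3] B by simp
  moreover have "coprime (2 :: nat) 7" "coprime (3 :: nat) 7"
    by (simp_all add: coprime_iff_gcd_eq_1 gcd_nat.simps)
  ultimately have "f 2 * f 7 = 2" using mult[of 2 7] by simp
  hence "f 2 * 3 * f 7 = 6" by simp
  hence f7: "f 7 = 3" unfolding f2 by simp
  have "f 21 = 1" using add3[of 1 2 4] q[of 1] q[of 2] q[of 4] B by simp
  thus False using mult[of 3 7] \<open>coprime 3 7\<close> f3 f7 by simp
qed

text \<open>Every sum of \<open>k\<close> positive squares would have value \<open>k\<close>, so
  coprime \<open>m\<close>, \<open>n\<close> with \<open>m\<close>, \<open>n\<close> and
  \<open>m * n\<close> all of this form give \<open>k = k^2\<close>. For \<open>k = 4\<close> the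
  choice is 4, 7, 28; for larger \<open>k\<close>, two large consecutive integers.\<close>

lemma not_constant_on_squares:
  assumes k4: "k \<ge> 4" and q: "\<And>a. 0 < a \<Longrightarrow> f (a\<^sup>2) = 1"
  shows False
proof -
  have const: "f n = of_nat k" if n: "n \<in> sums_of_positive_squares k" for n
  proof -
    obtain xs where xs: "length xs = k" "\<And>x. x \<in> set xs \<Longrightarrow> 0 < x" "n = (\<Sum>x\<leftarrow>xs. x\<^sup>2)"
      using n unfolding sums_of_positive_squares_def by blast
    have "f n = (\<Sum>x\<leftarrow>xs. f (x\<^sup>2))" using additive[of xs] xs by simp
    also have "\<dots> = (\<Sum>x\<leftarrow>xs. 1)" by (intro arg_cong[of _ _ sum_list] map_cong) (use xs q in auto)
    finally show ?thesis using xs by (simp add: sum_list_triv)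
  qed
  obtain m n where mn: "0 < m" "0 < n" "coprime m n" "m \<in> sums_of_positive_squares k"
    "n \<in> sums_of_positive_squares k" "m * n \<in> sums_of_positive_squares k"
  proof (cases "k = 4")
    case True
    show ?thesis
    proof (rule that[of 4 7])
      show "coprime (4 :: nat) 7" by (simp add: coprime_iff_gcd_eq_1 gcd_nat.simps)
      show "4 \<in> sums_of_positive_squares k"
        by (rule sum_list_in_sums_of_positive_squares[of "[1, 1, 1, 1]"]) (use True in auto)
      show "7 \<in> sums_of_positive_squares k"
        by (rule sum_list_in_sums_of_positive_squares[of "[1, 1, 1, 2]"]) (use True in auto)
      show "4 * 7 \<in> sums_of_positive_squares k"
        by (rule sum_list_in_sums_of_positive_squares[of "[1, 1, 1, 5]"]) (use True in auto)
    qed auto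
  next
    case False
    show ?thesis
    proof (rule that[of "k + 165" "k + 166"])
      show "(k + 165) * (k + 166) \<in> sums_of_positive_squares k"
        using False k4 by (intro large_in_sums_of_positive_squares) (auto simp: algebra_simps)
      show "coprime (k + 165) (k + 166)" using coprime_Suc_right_nat[of "k + 165"] by (simp add: add.commute)
    qed (use False k4 in \<open>auto intro!: large_in_sums_of_positive_squares\<close>)
  qed
  have "of_nat k = of_nat k * (of_nat k :: complex)"
    using mult[OF mn(1-3)] mn(4-6) const by simp
  thus False using k by simp
qed

lemma square_values:
  assumes "a > 0"
  shows "f (a\<^sup>2) = of_nat (a\<^sup>2)"
proof -
  obtain A B C where q: "\<And>a. 0 < a \<Longrightarrow> f (a\<^sup>2) = A * (of_nat a)\<^sup>2 + B + (if odd a then C else 0)"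
    and sum: "A + B + C = 1" and A: "A = 0 \<or> A = 1" and C: "k \<ge> 4 \<Longrightarrow> C = 0"
    using square_values_quadratic by blast
  have "A \<noteq> 0"
  proof
    assume "A = 0"
    hence "f (a\<^sup>2) = (if odd a then 1 else B)" if "0 < a" for a using q[OF that] sum by simp
    thus False
      using not_one_on_odd_squares not_constant_on_squares C k sum \<open>A = 0\<close>
      by (cases "k = 3") force+
  qed
  hence A: "A = 1" using A by blast
  hence C: "C = - B" using sum by (simp add: add_eq_0_iff)
  \<comment> \<open>With \<open>A = 1\<close> and \<open>C = -B\<close> the equation reads
    \<open>36 + B = (4 + B) * 9\<close>.\<close>
  have "coprime (4 :: nat) 9" by (simp add: coprime_iff_gcd_eq_1 gcd_nat.simps)
  hence "f (2\<^sup>2 * 3\<^sup>2) = f (2\<^sup>2) * f (3\<^sup>2)" by (intro mult) auto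
  moreover have "(2\<^sup>2 * 3\<^sup>2 :: nat) = 6\<^sup>2" by simp
  ultimately have "B = 0" using q[of 2] q[of 3] q[of 6] A C by simp
  thus ?thesis using q[OF assms] A C by simp
qed

section \<open>Values at all positive integers\<close>

lemma sums_of_squares_values:
  assumes "n \<in> sums_of_positive_squares k"
  shows "f n = of_nat n"
proof -
  obtain xs where xs: "length xs = k" "\<And>x. x \<in> set xs \<Longrightarrow> 0 < x" "n = (\<Sum>x\<leftarrow>xs. x\<^sup>2)"
    using assms unfolding sums_of_positive_squares_def by blast
  have "f n = (\<Sum>x\<leftarrow>xs. f (x\<^sup>2))" using additive[of xs] xs by simp
  also have "\<dots> = (\<Sum>x\<leftarrow>xs. of_nat (x\<^sup>2))"
    by (intro arg_cong[of _ _ sum_list] map_cong) (use xs square_values in auto)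
  also have "\<dots> = of_nat n" unfolding xs(3) by (induction xs) auto
  finally show ?thesis .
qed

lemma value_by_cancellation:
  assumes "0 < m" "0 < n" "coprime m n" "f m = of_nat m" "f (m * n) = of_nat (m * n)"
  shows "f n = of_nat n"
  using mult[OF assms(1-3)] assms by simp

lemma values_if_ge_5:
  assumes k5: "k \<ge> 5" and n: "n > 0"
  shows "f n = of_nat n"
proof (rule value_by_cancellation)
  \<comment> \<open>Congruent to 1 modulo \<open>n\<close>, and large enough for both
    \<open>m\<close> and \<open>m * n\<close> to be sums of \<open>k\<close> positive
    squares.\<close>
  define m where "m = n * (165 + k) + 1"
  have m: "m \<ge> 165 + k" "m * n \<ge> m" unfolding m_def using n by (cases n; simp)+
  show "f m = of_nat m" "f (m * n) = of_nat (m * n)"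
    using m(1) order_trans[OF m] k5
    by (intro sums_of_squares_values large_in_sums_of_positive_squares; simp)+
  show "coprime m n"
  proof (rule coprimeI)
    fix d assume "d dvd m" "d dvd n"
    thus "is_unit d" unfolding m_def using dvd_add_right_iff[of d "n * (165 + k)" 1] by simp
  qed
  show "0 < m" by (simp add: m_def)
qed fact

text \<open>Covers the primes 2, 3, 5 by explicit multiples: 6, 3, 30 for \<open>k = 3\<close> and
  10, 12, 15 for \<open>k = 4\<close>. Here \<open>m\<close> may exceed \<open>p\<close>, so its
  value is supplied directly and not by induction.\<close>

lemma small_prime_multiple:
  assumes k: "k = 3 \<or> k = 4" and p: "prime p" "p \<le> 5"
  obtains m where "0 < m" "coprime m p" "f m = of_nat m" "m * p \<in> sums_of_positive_squares k"
proof -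
  have "p \<in> {0, 1, 2, 3, 4, 5}" using p(2) by auto
  moreover have "\<not> prime (4 :: nat)" using prime_product[of 2 2] by auto
  ultimately have p: "p = 2 \<or> p = 3 \<or> p = 5" using p(1) by auto
  have coprimes: "coprime (3::nat) 2" "coprime (6::nat) 5" "coprime (5::nat) 2" "coprime (4::nat) 3"
      "coprime (3::nat) 5"
    by (simp_all add: coprime_iff_gcd_eq_1 gcd_nat.simps)
  show ?thesis
  proof (cases "k = 3")
    case True
    have rep: "a\<^sup>2 + b\<^sup>2 + c\<^sup>2 \<in> sums_of_positive_squares k" if "0 < a" "0 < b" "0 < c" for a b c
      by (rule sum_list_in_sums_of_positive_squares[of "[a, b, c]"]) (use True that in auto)
    have S: "3 \<in> sums_of_positive_squares k" "6 \<in> sums_of_positive_squares k"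
      "30 \<in> sums_of_positive_squares k"
      using rep[of 1 1 1] rep[of 1 1 2] rep[of 1 2 5] by (simp_all add: numeral_3_eq_3)
    show ?thesis
      using p that[of 3] that[of 1] that[of 6] S coprimes one sums_of_squares_values[of 3]
        sums_of_squares_values[of 6] by auto
  next
    case False
    hence k4: "k = 4" using k by simp
    have rep: "a\<^sup>2 + b\<^sup>2 + c\<^sup>2 + d\<^sup>2 \<in> sums_of_positive_squares k"
      if "0 < a" "0 < b" "0 < c" "0 < d" for a b c d
      by (rule sum_list_in_sums_of_positive_squares[of "[a, b, c, d]"]) (use k4 that in auto)
    have S: "10 \<in> sums_of_positive_squares k" "12 \<in> sums_of_positive_squares k"
      "15 \<in> sums_of_positive_squares k"
      using rep[of 1 1 2 2] rep[of 1 1 1 3] rep[of 1 1 2 3] by simp_all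
    have f4: "f 4 = 4" using square_values[of 2] by simp
    have f3: "f 3 = 3" using value_by_cancellation[of 4 3] f4 sums_of_squares_values[OF S(2)] coprimes
      by simp
    have f5: "f 5 = 5" using value_by_cancellation[of 3 5] f3 sums_of_squares_values[OF S(3)] coprimes
      by simp
    show ?thesis
      using p that[of 5] that[of 4] that[of 3] S coprimes f3 f4 f5 by auto
  qed
qed

lemma values_if_le_4:
  assumes k4: "k \<le> 4" and "n > 0"
  shows "f n = of_nat n"
  using assms(2)
proof (induction n rule: less_induct)
  case (less n)
  have k34: "k = 3 \<or> k = 4" using k k4 by auto
  show ?case
  proof (cases "n = 1")
    case True
    thus ?thesis using one by simp
  next
    case False
    then obtain p where p: "prime p" "p dvd n" using prime_factor_nat by blast
    define e where "e = multiplicity p n"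
    have "\<not> is_unit p" using p by auto
    then obtain r where r: "n = p ^ e * r" "\<not> p dvd r"
      using multiplicity_decompose'[of n p] less.prems unfolding e_def by auto
    have r0: "r > 0" using r less.prems by (auto intro: Nat.gr0I)
    have p1: "p > 1" using p prime_gt_1_nat by blast
    show ?thesis
    proof (cases "r = 1")
      case False
      have e0: "e \<noteq> 0" using r p(2) by (intro notI) simp
      have "1 < p ^ e" using p1 e0 by (intro one_less_power) auto
      hence less_n: "p ^ e < n" "r < n" using r0 False p1 unfolding r(1) by auto
      have "coprime (p ^ e) r" using prime_imp_coprime[OF p(1) r(2)] by simp
      hence "f n = f (p ^ e) * f r" unfolding r(1) using r0 p1 by (intro mult) auto
      also have "f (p ^ e) = of_nat (p ^ e)" using less_n(1) p1 by (intro less.IH) auto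
      also have "f r = of_nat r" using less_n(2) r0 by (intro less.IH)
      finally show ?thesis unfolding r(1) by simp
    next
      case True
      hence n: "n = p ^ e" using r by simp
      show ?thesis
      proof (cases "even e")
        case True
        then obtain j where "e = 2 * j" by auto
        hence "n = (p ^ j)\<^sup>2" using n by (simp add: power_even_eq)
        thus ?thesis using square_values[of "p ^ j"] p1 by simp
      next
        case False
        obtain m where m: "0 < m" "coprime m p" "f m = of_nat m" "m * p \<in> sums_of_positive_squares k"
        proof (cases "p \<le> 5")
          case True
          thus ?thesis using small_prime_multiple[OF k34 p(1)] that by blast
        next
          case False
          hence "p > 5" by simp
          then obtain m where m: "0 < m" "m < p" "m * p \<in> sums_of_positive_squares k"
            using prime_multiple_in_sums_of_positive_squares[OF p(1) _ k34] by blast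
          have "\<not> p dvd m" using m(1,2) by (rule nat_dvd_not_less)
          hence "coprime m p" using prime_imp_coprime[OF p(1)] by (simp add: coprime_commute)
          \<comment> \<open>Thus \<open>m < p \<le> n\<close>, which puts \<open>m\<close> within
            reach of the induction hypothesis.\<close>
          moreover have "p \<le> n" using p(2) less.prems by (rule dvd_imp_le)
          moreover have "f m = of_nat m" using m \<open>p \<le> n\<close> by (intro less.IH) auto
          ultimately show ?thesis using that m by blast
        qed
        obtain j where "e = 2 * j + 1" using False by (rule oddE)
        hence "n = (p ^ j)\<^sup>2 * p" using n by (simp add: power_even_eq)
        hence "m * n = (p ^ j)\<^sup>2 * (m * p)" by simp
        moreover have "(p ^ j)\<^sup>2 * (m * p) \<in> sums_of_positive_squares k"
          using m(4) p1 by (intro sums_of_positive_squares_scale) auto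
        ultimately have "f (m * n) = of_nat (m * n)" using sums_of_squares_values by metis
        moreover have "coprime m n" unfolding n using m(2) by simp
        ultimately show ?thesis using value_by_cancellation m(1,3) less.prems by blast
      qed
    qed
  qed
qed

end

theorem theorem1:
  fixes k :: nat and f :: "nat \<Rightarrow> complex"
  assumes "k \<ge> 3"
    and "multiplicative_fun f"
    and "\<And>a :: nat \<Rightarrow> nat. (\<forall>i\<in>{1..k}. a i > 0) \<Longrightarrow>
           f (\<Sum>i = 1..k. (a i)\<^sup>2) = (\<Sum>i = 1..k. f ((a i)\<^sup>2))"
  shows "\<forall>n > 0. f n = of_nat n"
proof -
  interpret additive_on_squares k f
  proof
    fix xs :: "nat list" assume xs: "length xs = k" "\<And>x. x \<in> set xs \<Longrightarrow> 0 < x"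
    define a where "a i = xs ! (i - 1)" for i
    \<comment> \<open>Polymorphic in the target type, since it rewrites both the sum of squares in
      \<open>nat\<close> and the sum of complex values.\<close>
    have *: "(\<Sum>x\<leftarrow>xs. h x) = (\<Sum>i = 1..k. h (a i))" for h :: "nat \<Rightarrow> 'b :: comm_monoid_add"
    proof -
      have "(\<Sum>x\<leftarrow>xs. h x) = (\<Sum>i = 0..<k. h (xs ! i))"
        using xs(1) by (simp add: sum_list_sum_nth)
      also have "\<dots> = (\<Sum>i = 1..k. h (a i))"
        by (rule sum.reindex_bij_witness[of _ "\<lambda>i. i - 1" Suc]) (auto simp: a_def)
      finally show ?thesis .
    qed
    have "\<forall>i\<in>{1..k}. a i > 0" unfolding a_def using xs by (auto intro!: xs(2) nth_mem)
    thus "f (\<Sum>x\<leftarrow>xs. x\<^sup>2) = (\<Sum>x\<leftarrow>xs. f (x\<^sup>2))" unfolding * by (rule assms(3))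
  next
    show "k \<ge> 3" by fact
  next
    show "f 1 = 1" using assms(2) unfolding multiplicative_fun_def by blast
  next
    fix m n :: nat assume mn: "0 < m" "0 < n" "coprime m n"
    have "gcd m n = 1" using mn(3) by simp
    thus "f (m * n) = f m * f n" using assms(2) mn(1,2) unfolding multiplicative_fun_def by simp
  qed
  show ?thesis
  proof (intro allI impI)
    fix n :: nat assume "n > 0"
    thus "f n = of_nat n" using values_if_ge_5 values_if_le_4 by (cases "k \<ge> 5") simp_all
  qed
qed

end
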